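(* Let $r,s>1$ be integers, let $m_1,\ldots,m_r$ and $n_1,\ldots,n_s$ be positive integers, and set $m_{r+1}=m_1$, $n_{s+1}=n_1$. For all integers $a,b$ with $0\leq a\leq s$ and $1\leq b\leq r$, the expression \[ F_{r,s}^{(b)}(\mathbf m;\mathbf n;a;q)=\frac{[m_1]!\,[n_1]!\,[m_r+n_s+1]!}{[m_1+m_r+1]!\,[n_1+n_s]!}\sum_{k=-n_1}^{n_1}(-1)^k q^{a k^2+(2b-1)\binom{k}{2}}\prod_{i=1}^{r}\begin{bmatrix} m_i+m_{i+1}+1\\ m_i+k\end{bmatrix}\prod_{j=1}^{s}\begin{bmatrix} n_j+n_{j+1}\\ n_j+k\end{bmatrix} \] is a polynomial in $q$ with non-negative integer coefficients.
   Context: For a non-negative integer $n$, $[n]=\frac{1-q^n}{1-q}$, $[n]!=[1][2]\cdots[n]$, $[0]!=1$. For integers $N,K$, the Gaussian coefficient is $\begin{bmatrix} N\\ K\end{bmatrix}=\frac{[N]!}{[K]![N-K]!}$ if $0\le K\le N$ and $0$ otherwise. Here $\binom{k}{2}=k(k-1)/2$ for every integer $k$, $\mathbf m=(m_1,\ldots,m_r)$, $\mathbf n=(n_1,\ldots,n_s)$. *)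

theory Defs
  imports "HOL-Computational_Algebra.Computational_Algebra"
begin

text \<open>The definitions are parametrised by an element \<open>q\<close> of a field. They have their intended
  meaning for \<open>q\<close> that are neither zero nor a root of unity, in particular for the
  indeterminate \<open>qvar\<close>; for other \<open>q\<close> the convention \<open>x / 0 = 0\<close> interferes.\<close>

definition qint :: "'a::field \<Rightarrow> nat \<Rightarrow> 'a" where
  "qint q n = (1 - q ^ n) / (1 - q)"

definition qfact :: "'a::field \<Rightarrow> nat \<Rightarrow> 'a" where
  "qfact q n = (\<Prod>i=1..n. qint q i)"

definition qbinom :: "'a::field \<Rightarrow> int \<Rightarrow> int \<Rightarrow> 'a" where
  "qbinom q N K =
     (if 0 \<le> K \<and> K \<le> N then qfact q (nat N) / (qfact q (nat K) * qfact q (nat (N - K))) else 0)"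

text \<open>\<open>binom2 k\<close> is \<open>k(k - 1)/2\<close> for every integer \<open>k\<close>, also negative (the division is exact).\<close>

definition binom2 :: "int \<Rightarrow> int" where
  "binom2 k = k * (k - 1) div 2"

text \<open>The tuples are given as functions of which only the values at \<open>1, \<dots>, r + 1\<close>
  (respectively \<open>1, \<dots>, s + 1\<close>) are used; users have to impose \<open>m (r + 1) = m 1\<close> and
  \<open>n (s + 1) = n 1\<close>.\<close>

definition F :: "nat \<Rightarrow> nat \<Rightarrow> int \<Rightarrow> (nat \<Rightarrow> nat) \<Rightarrow> (nat \<Rightarrow> nat) \<Rightarrow> int \<Rightarrow> 'a::field \<Rightarrow> 'a" where
  "F r s b m n a q =
     qfact q (m 1) * qfact q (n 1) * qfact q (m r + n s + 1) /
       (qfact q (m 1 + m r + 1) * qfact q (n 1 + n s)) *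
     (\<Sum>k = - int (n 1)..int (n 1).
        (-1) powi k * q powi (a * k\<^sup>2 + (2 * b - 1) * binom2 k) *
        (\<Prod>i=1..r. qbinom q (int (m i) + int (m (i + 1)) + 1) (int (m i) + k)) *
        (\<Prod>j=1..s. qbinom q (int (n j) + int (n (j + 1))) (int (n j) + k)))"

text \<open>The indeterminate \<open>q\<close> as an element of the field of fractions of \<open>\<int>[q]\<close>, that is,
  of the field of rational functions \<open>\<rat>(q)\<close>.\<close>

definition qvar :: "int poly fract" where
  "qvar = to_fract [:0, 1:]"

definition nonneg_int_polynomial :: "int poly fract \<Rightarrow> bool" where
  "nonneg_int_polynomial f \<longleftrightarrow> (\<exists>p. f = to_fract p \<and> (\<forall>i. coeff p i \<ge> 0))"

end

theory Submission
  imports Defs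
begin

text \<open>After cancelling the prefactor, \<open>F\<close> becomes a sum over \<open>k\<close> attached to the path
  \<open>m\<^sub>1, \<dots>, m\<^sub>r, n\<^sub>s, \<dots>, n\<^sub>1\<close>: each edge contributes a \<open>q\<close>-factorial, and each node a
  product of two reciprocal \<open>q\<close>-factorials depending on \<open>k\<close>. The \<open>q\<close>-Vandermonde identity
  replaces the first two nodes of either family by a single node \<open>l\<close>, summed over \<open>l\<close>;
  the remaining factors combine to a power of \<open>q\<close> times two Gaussian coefficients. There are two
  versions of the identity, one of which lowers \<open>a\<close> (or \<open>b\<close>) by one, so any
  \<open>0 \<le> a \<le> s\<close>, \<open>1 \<le> b \<le> r\<close> can be brought down to \<open>r = s = 1\<close>, \<open>b = 1\<close>,
  \<open>a \<in> {0, 1}\<close>. In that case \<open>F\<close> is a power of \<open>q\<close>: merging the last two nodes leaves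
  \<open>\<Sum>k. (-1)^k q^(k choose 2) / ([l + k]! [l - k]!)\<close>, which after symmetrisation telescopes to zero
  unless \<open>l = 0\<close>.\<close>

section \<open>\<open>q\<close>-analogues with integer arguments\<close>

definition qint_int :: "'a::field \<Rightarrow> int \<Rightarrow> 'a" where
  "qint_int q N = (1 - q powi N) / (1 - q)"

text \<open>The value \<open>0\<close> at negative arguments makes \<open>1/[N - 1]! = [N]/[N]!\<close> hold for every integer \<open>N\<close>.\<close>

definition rfact :: "'a::field \<Rightarrow> int \<Rightarrow> 'a" where
  "rfact q N = (if N < 0 then 0 else 1 / qfact q (nat N))"

text \<open>The Gaussian coefficient as a plain product: its vanishing outside \<open>0..N\<close>
  comes from \<open>rfact\<close>, so identities in \<open>K\<close> need no case
  distinction.\<close>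

definition gauss :: "'a::field \<Rightarrow> nat \<Rightarrow> int \<Rightarrow> 'a" where
  "gauss q N K = qfact q N * rfact q K * rfact q (int N - K)"

lemma double_binom2: "2 * binom2 k = k * (k - 1)"
  unfolding binom2_def by (cases "even k") auto

lemma binom2_succ: "binom2 (1 + k) = binom2 k + k"
proof -
  have "2 * binom2 (1 + k) = 2 * (binom2 k + k)"
    unfolding double_binom2 distrib_left by (simp add: algebra_simps)
  then show ?thesis by simp
qed

lemma binom2_uminus: "binom2 (- k) = binom2 k + k"
proof -
  have "2 * binom2 (- k) = 2 * (binom2 k + k)"
    unfolding double_binom2 distrib_left by (simp add: algebra_simps)
  then show ?thesis by simp
qed

lemma qfact_0 [simp]: "qfact q 0 = 1"
  by (simp add: qfact_def)

lemma rfact_neg [simp]: "N < 0 \<Longrightarrow> rfact q N = 0"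
  by (simp add: rfact_def)

lemma rfact_0 [simp]: "rfact q 0 = 1"
  by (simp add: rfact_def)

lemma rfact_of_nat: "rfact q (int N) = 1 / qfact q N"
  by (simp add: rfact_def)

lemma gauss_neg: "K < 0 \<Longrightarrow> gauss q N K = 0"
  and gauss_large: "K > int N \<Longrightarrow> gauss q N K = 0"
  by (auto simp: gauss_def)

lemma qbinom_eq_gauss: "qbinom q (int N) K = gauss q N K"
  by (auto simp: qbinom_def gauss_def rfact_def)

section \<open>Sums over integer intervals\<close>

lemma sum_symmetric:
  fixes f :: "int \<Rightarrow> 'a::comm_monoid_add"
  shows "(\<Sum>k=-N..N. f (- k)) = (\<Sum>k=-N..N. f k)"
  by (rule sum.reindex_bij_witness[of _ uminus uminus]) auto

lemma minus_one_powi_succ: "(-1::'a::field) powi (k + 1) = - ((-1) powi k)"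
  by (simp add: power_int_add)

lemma sum_telescope_int:
  fixes h :: "int \<Rightarrow> 'a::ab_group_add"
  assumes "h (- N) = 0" "h (N + 1) = 0"
  shows "(\<Sum>k=-N..N. h k - h (k + 1)) = 0"
proof -
  have "(\<Sum>k=-N..N. h (k + 1)) = (\<Sum>k=-N+1..N+1. h k)"
    by (rule sum.reindex_bij_witness[of _ "\<lambda>k. k - 1" "\<lambda>k. k + 1"]) auto
  also have "\<dots> = (\<Sum>k=-N..N+1. h k)"
  proof (rule sum.mono_neutral_left)
    show "\<forall>k\<in>{-N..N+1} - {-N+1..N+1}. h k = 0"
    proof
      fix k assume "k \<in> {-N..N+1} - {-N+1..N+1}"
      then have "k = - N" by auto
      then show "h k = 0" using assms by simp
    qed
  qed auto
  also have "\<dots> = (\<Sum>k=-N..N. h k)"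
  proof (rule sum.mono_neutral_right)
    show "\<forall>k\<in>{-N..N+1} - {-N..N}. h k = 0"
    proof
      fix k assume "k \<in> {-N..N+1} - {-N..N}"
      then have "k = N + 1" by auto
      then show "h k = 0" using assms by simp
    qed
  qed auto
  finally show ?thesis by (simp add: sum_subtractf)
qed

lemma sum_int_atMost:
  fixes f :: "int \<Rightarrow> 'a::comm_monoid_add"
  shows "(\<Sum>l=0..int x. f l) = (\<Sum>l\<le>x. f (int l))"
  by (rule sum.reindex_bij_witness[of _ int nat]) auto

section \<open>Pascal, Vandermonde and merging of nodes for generic \<open>q\<close>\<close>

text \<open>The first two conditions make all \<open>q\<close>-factorials invertible;
  \<open>2 \<noteq> 0\<close> allows averaging over \<open>k\<close> and \<open>- k\<close>.\<close>

locale generic_q =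
  fixes q :: "'a::field"
  assumes q_nonzero [simp]: "q \<noteq> 0"
    and q_power_neq_1: "n > 0 \<Longrightarrow> q ^ n \<noteq> 1"
    and two_nonzero: "(2::'a) \<noteq> 0"
begin

lemma q_neq_1 [simp]: "q \<noteq> 1" "1 - q \<noteq> 0"
  using q_power_neq_1[of 1] by auto

lemma qint_nonzero: "n > 0 \<Longrightarrow> qint q n \<noteq> 0"
  using q_power_neq_1[of n] by (simp add: qint_def)

lemma qfact_nonzero [simp]: "qfact q n \<noteq> 0"
  by (auto simp: qfact_def qint_nonzero)

lemma qfact_Suc: "qfact q (Suc n) = qint_int q (int (Suc n)) * qfact q n"
  unfolding qfact_def qint_int_def qint_def power_int_of_nat
  by (simp add: mult.commute)

lemma qint_int_0 [simp]: "qint_int q 0 = 0"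
  by (simp add: qint_int_def)

lemma qint_int_pos_nonzero: "n > 0 \<Longrightarrow> qint_int q (int n) \<noteq> 0"
  using qint_nonzero[of n] by (simp add: qint_int_def qint_def)

lemma qint_int_add: "qint_int q (M + N) = qint_int q M + q powi M * qint_int q N"
  by (simp add: qint_int_def power_int_add field_simps)

lemma rfact_pred: "rfact q (N - 1) = qint_int q N * rfact q N"
proof -
  consider "N < 0" | "N = 0" | n where "N = int (Suc n)"
    by (metis int_cases neg_less_0_iff_less of_nat_0_less_iff of_nat_0 zero_less_Suc not0_implies_Suc)
  then show ?thesis
  proof cases
    case 3
    have "N - 1 = int n" using 3 by simp
    moreover have "rfact q (int n) = qint_int q (int (Suc n)) * rfact q (int (Suc n))"
      unfolding rfact_of_nat qfact_Suc using qint_int_pos_nonzero[of "Suc n"]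
      by (simp del: of_nat_Suc)
    ultimately show ?thesis by (simp only: 3)
  qed auto
qed

text \<open>Split \<open>[N + 1] = [K] + q^K [N + 1 - K]\<close>; each summand lowers one of the two
  reciprocal factorials by \<open>rfact_pred\<close>.\<close>

lemma gauss_pascal: "gauss q (Suc N) K = gauss q N (K - 1) + q powi K * gauss q N K"
proof -
  have 1: "rfact q (int N - K) = qint_int q (int (Suc N) - K) * rfact q (int (Suc N) - K)"
    using rfact_pred[of "int (Suc N) - K"] by (simp add: algebra_simps)
  have 2: "int N - (K - 1) = int (Suc N) - K" by simp
  have 3: "qint_int q (int (Suc N)) = qint_int q K + q powi K * qint_int q (int (Suc N) - K)"
    using qint_int_add[of K "int (Suc N) - K"] by simp
  show ?thesis unfolding gauss_def 1 2 rfact_pred qfact_Suc 3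
    by (simp add: algebra_simps)
qed

lemma gauss_0: "gauss q 0 K = (if K = 0 then 1 else 0)"
  by (cases "K > 0") (auto simp: gauss_def)

lemma gauss_symmetric: "gauss q N (int N - K) = gauss q N K"
  by (simp add: gauss_def)

lemma sum_gauss_support:
  assumes "finite S" "{0..int A} \<subseteq> S" "\<And>i. gauss q A i = 0 \<Longrightarrow> f i = 0"
  shows "(\<Sum>i\<in>S. f i) = (\<Sum>i=0..int A. f i)"
proof (rule sum.mono_neutral_right)
  show "\<forall>i\<in>S - {0..int A}. f i = 0"
    using assms(3) gauss_neg gauss_large by (metis DiffE atLeastAtMost_iff linorder_not_less)
qed (use assms in auto)

text \<open>Induction on \<open>A\<close>: Pascal's rule for \<open>gauss q (Suc A) i\<close> splits
  the sum into the instance at \<open>C - 1\<close>, shifted by one, and \<open>q^C\<close> times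
  the instance at \<open>C\<close>.\<close>

lemma q_vandermonde:
  "(\<Sum>i=0..int A. q powi ((int A - i) * (C - i)) * gauss q A i * gauss q B (C - i)) = gauss q (A + B) C"
proof (induction A arbitrary: C)
  case 0
  then show ?case by (simp add: gauss_0)
next
  case (Suc A)
  let ?S = "{0..int (Suc A)}"
  have "(\<Sum>i\<in>?S. q powi ((int (Suc A) - i) * (C - i)) * gauss q (Suc A) i * gauss q B (C - i))
     = (\<Sum>i\<in>?S. q powi ((int A - (i - 1)) * ((C - 1) - (i - 1))) * gauss q A (i - 1) * gauss q B ((C - 1) - (i - 1)))
     + q powi C * (\<Sum>i\<in>?S. q powi ((int A - i) * (C - i)) * gauss q A i * gauss q B (C - i))"
    unfolding sum_distrib_left sum.distrib[symmetric]
  proof (rule sum.cong[OF refl])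
    fix i
    have 1: "q powi ((int (Suc A) - i) * (C - i)) * q powi i = q powi C * q powi ((int A - i) * (C - i))"
      by (simp flip: power_int_add add: algebra_simps)
    have 2: "int A - (i - 1) = int (Suc A) - i"
        "(C - 1) - (i - 1) = C - i"
      by simp_all
    have "q powi ((int (Suc A) - i) * (C - i)) * gauss q (Suc A) i * gauss q B (C - i) =
       q powi ((int (Suc A) - i) * (C - i)) * gauss q A (i - 1) * gauss q B (C - i)
       + (q powi ((int (Suc A) - i) * (C - i)) * q powi i) * (gauss q A i * gauss q B (C - i))"
      unfolding gauss_pascal by (simp only: distrib_left distrib_right mult.assoc)
    then show "q powi ((int (Suc A) - i) * (C - i)) * gauss q (Suc A) i * gauss q B (C - i) =
       q powi ((int A - (i - 1)) * ((C - 1) - (i - 1))) * gauss q A (i - 1) * gauss q B ((C - 1) - (i - 1))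
       + q powi C * (q powi ((int A - i) * (C - i)) * gauss q A i * gauss q B (C - i))"
      unfolding 1 2 by (simp only: mult.assoc)
  qed
  also have "(\<Sum>i\<in>?S. q powi ((int A - (i - 1)) * ((C - 1) - (i - 1))) * gauss q A (i - 1) * gauss q B ((C - 1) - (i - 1)))
     = (\<Sum>i=-1..int A. q powi ((int A - i) * ((C - 1) - i)) * gauss q A i * gauss q B ((C - 1) - i))"
    by (rule sum.reindex_bij_witness[of _ "\<lambda>i. i + 1" "\<lambda>i. i - 1"]) auto
  also have "\<dots> = gauss q (A + B) (C - 1)"
    unfolding Suc.IH[symmetric] by (rule sum_gauss_support) auto
  also have "(\<Sum>i\<in>?S. q powi ((int A - i) * (C - i)) * gauss q A i * gauss q B (C - i))
     = gauss q (A + B) C"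
    unfolding Suc.IH[symmetric] by (rule sum_gauss_support) auto
  finally show ?case by (simp add: gauss_pascal)
qed

text \<open>Reverse the summation by \<open>i \<mapsto> A - i\<close> and use the symmetry of all
  three Gaussian coefficients.\<close>

lemma q_vandermonde':
  "(\<Sum>i=0..int A. q powi (i * (int B - C + i)) * gauss q A i * gauss q B (C - i)) = gauss q (A + B) C"
proof -
  have "(\<Sum>i=0..int A. q powi (i * (int B - C + i)) * gauss q A i * gauss q B (C - i)) =
    (\<Sum>i=0..int A. q powi ((int A - i) * ((int (A + B) - C) - i)) * gauss q A i * gauss q B ((int (A + B) - C) - i))"
  proof (rule sum.reindex_bij_witness[of _ "\<lambda>i. int A - i" "\<lambda>i. int A - i"])
    fix i
    have "gauss q B (int (A + B) - C - (int A - i)) = gauss q B (C - i)"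
      using gauss_symmetric[of B "C - i"] by (simp add: algebra_simps)
    then show "q powi ((int A - (int A - i)) * (int (A + B) - C - (int A - i))) * gauss q A (int A - i) * gauss q B (int (A + B) - C - (int A - i))
       = q powi (i * (int B - C + i)) * gauss q A i * gauss q B (C - i)"
      by (simp add: gauss_symmetric algebra_simps)
  qed auto
  then show ?thesis unfolding q_vandermonde gauss_symmetric .
qed

text \<open>Both forms of the \<open>q\<close>-Vandermonde identity: \<open>d = 1\<close> absorbs one factor
  \<open>q ^ (k (k - e))\<close>, while \<open>d = 0\<close> leaves the power of \<open>q\<close> unchanged. The nodes \<open>n\<^sub>j\<close> have
  \<open>e = 0\<close>, the nodes \<open>m\<^sub>i\<close> have \<open>e = 1\<close>.\<close>

lemma merge_nodes:
  fixes e k :: int and x y :: nat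
  assumes e: "e = 0 \<or> e = 1" and d: "d \<in> {0, 1}"
  defines "w \<equiv> \<lambda>l. if d = 1 then l * (l + e) else (int x - l) * (int y - l)"
  shows "qfact q (nat (int x + int y + e)) * q powi (d * (k * (k - e))) *
      (rfact q (int x + k) * rfact q (int x + e - k)) * (rfact q (int y + k) * rfact q (int y + e - k))
    = (\<Sum>l=0..int x. q powi (w l) * rfact q (int x - l) * rfact q (int y - l) *
         (rfact q (l + k) * rfact q (l + e - k)))" (is "?L = sum ?t _")
proof (cases "int x + e - k < 0 \<or> int y + k < 0")
  \<comment> \<open>Here a factor on the left vanishes. On the right, \<open>x - l\<close> and
    \<open>l + e - k\<close> add up to \<open>x + e - k\<close>, and \<open>y - l\<close> and
    \<open>l + k\<close> to \<open>y + k\<close>, so every term has a negative argument.\<close>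
  case True
  have "?t l = 0" for l
  proof -
    have "int x - l < 0 \<or> l + e - k < 0 \<or> int y - l < 0 \<or> l + k < 0"
      using True by linarith
    then show ?thesis by auto
  qed
  then have "sum ?t {0..int x} = 0" by (intro sum.neutral) blast
  moreover have "?L = 0" using True by auto
  ultimately show ?thesis by simp
next
  case False
  \<comment> \<open>With \<open>i = x - l\<close>, the Vandermonde summand produces exactly the four
    reciprocal factorials of the right-hand side, while \<open>A + B\<close> does not depend on
    \<open>k\<close>.\<close>
  define A B C where "A = nat (int x + e - k)" and "B = nat (int y + k)" and "C = int x + k"
  have AB: "int A = int x + e - k" "int B = int y + k"
    using False by (auto simp: A_def B_def)
  have sumAB: "A + B = nat (int x + int y + e)" "int (A + B) = int x + int y + e"
    using AB by auto
  define v where "v = (\<lambda>i. if d = 1 then (int A - i) * (C - i) else i * (int B - C + i))"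
  let ?f = "\<lambda>i. q powi (v i) * gauss q A i * gauss q B (C - i)"
  \<comment> \<open>This range contains \<open>{0..int A}\<close> and becomes
    \<open>{-\<bar>k\<bar>-1..int x}\<close> under \<open>i = x - l\<close>.\<close>
  let ?S = "{0..int x + \<bar>k\<bar> + 1}"
  have "gauss q (A + B) C = (\<Sum>i=0..int A. ?f i)"
    using q_vandermonde[where A=A and B=B and C=C] q_vandermonde'[where A=A and B=B and C=C]
    by (cases "d = 1") (simp_all add: v_def)
  also have "\<dots> = (\<Sum>i\<in>?S. ?f i)"
    by (rule sum_gauss_support[symmetric]) (use e in \<open>auto simp: AB\<close>)
  also have "\<dots> = (\<Sum>l=-\<bar>k\<bar>-1..int x. ?f (int x - l))"
    by (rule sum.reindex_bij_witness[of _ "\<lambda>l. int x - l" "\<lambda>i. int x - i"]) auto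
  finally have "q powi (d * (k * (k - e))) * gauss q (A + B) C
      = (\<Sum>l=-\<bar>k\<bar>-1..int x. q powi (d * (k * (k - e))) * ?f (int x - l))"
    by (simp add: sum_distrib_left)
  also have "\<dots> = (\<Sum>l=-\<bar>k\<bar>-1..int x. qfact q A * qfact q B * ?t l)"
  proof (rule sum.cong[OF refl])
    fix l
    have 1: "q powi (w l) = q powi (d * (k * (k - e))) * q powi v (int x - l)"
      using d by (auto simp flip: power_int_add simp: v_def w_def AB C_def algebra_simps)
    have 2: "gauss q A (int x - l) = qfact q A * (rfact q (int x - l) * rfact q (l + e - k))"
      by (simp add: gauss_def AB algebra_simps)
    have 3: "gauss q B (C - (int x - l)) = qfact q B * (rfact q (int y - l) * rfact q (l + k))"
      by (simp add: gauss_def AB C_def algebra_simps)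
    show "q powi (d * (k * (k - e))) * ?f (int x - l) = qfact q A * qfact q B * ?t l"
      unfolding 1 2 3 by (simp only: mult_ac)
  qed
  also have "\<dots> = (\<Sum>l=0..int x. qfact q A * qfact q B * ?t l)"
  proof (rule sum.mono_neutral_right)
    show "\<forall>l\<in>{-\<bar>k\<bar>-1..int x} - {0..int x}. qfact q A * qfact q B * ?t l = 0"
    proof
      fix l assume "l \<in> {-\<bar>k\<bar>-1..int x} - {0..int x}"
      \<comment> \<open>The two arguments add up to \<open>2 * l + e\<close>, which is negative for
        \<open>l < 0\<close>.\<close>
      then have "l + k < 0 \<or> l + e - k < 0" using e by auto
      then show "qfact q A * qfact q B * ?t l = 0" by auto
    qed
  qed auto
  finally have "q powi (d * (k * (k - e))) * gauss q (A + B) C = qfact q A * qfact q B * sum ?t {0..int x}"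
    by (simp only: sum_distrib_left)
  moreover have "?L * (qfact q A * qfact q B) = q powi (d * (k * (k - e))) * gauss q (A + B) C"
  proof -
    have AB1: "rfact q (int x + e - k) * qfact q A = 1" "rfact q (int y + k) * qfact q B = 1"
      by (simp_all flip: AB add: rfact_of_nat)
    have C1: "gauss q (A + B) C = qfact q (nat (int x + int y + e)) * rfact q (int x + k) * rfact q (int y + e - k)"
    proof -
      have *: "int (A + B) - C = int y + e - k" unfolding sumAB(2) C_def by simp
      show ?thesis unfolding gauss_def sumAB(1)[symmetric] * by (simp add: C_def)
    qed
    have "?L * (qfact q A * qfact q B) = q powi (d * (k * (k - e))) *
       (qfact q (nat (int x + int y + e)) * rfact q (int x + k) * rfact q (int y + e - k)) *
       (rfact q (int x + e - k) * qfact q A) * (rfact q (int y + k) * qfact q B)"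
      by (simp only: mult_ac)
    then show ?thesis by (simp only: AB1 C1 mult_1_right)
  qed
  ultimately have "?L * (qfact q A * qfact q B) = qfact q A * qfact q B * sum ?t {0..int x}"
    by (rule trans[rotated])
  moreover have "qfact q A * qfact q B \<noteq> 0" by simp
  ultimately show ?thesis
    using mult_right_cancel[THEN iffD1, OF _ trans[OF _ mult.commute]] by blast
qed

section \<open>Alternating sums over one and two nodes\<close>

lemma qint_int_double: "qint_int q N * (1 + q powi k) = qint_int q (N + k) + q powi k * qint_int q (N - k)"
proof -
  have "q powi k * q powi (N - k) = q powi N" by (simp flip: power_int_add)
  then show ?thesis
    by (simp add: qint_int_def power_int_add add_divide_distrib diff_divide_distrib algebra_simps)
qed

text \<open>Without \<open>q^k\<close>, the second summand is the first at \<open>k + 1\<close>;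
  with the weight \<open>(-1)^k q^(binom2 k)\<close> the right-hand side therefore becomes a
  telescoping difference.\<close>

lemma rfact_split:
  "qint_int q N * (1 + q powi k) * (rfact q (N + k) * rfact q (N - k))
     = rfact q (N - 1 + k) * rfact q (N - k) + q powi k * (rfact q (N + k) * rfact q (N - 1 - k))"
  unfolding qint_int_double using rfact_pred[of "N + k"] rfact_pred[of "N - k"]
  by (simp add: algebra_simps)

text \<open>Since \<open>binom2 (- k) = binom2 k + k\<close>, the reflection
  \<open>k \<mapsto> - k\<close> of an even summand produces exactly the factor
  \<open>q^k\<close>.\<close>

lemma sum_twist:
  assumes "\<And>k. E (- k) = E k"
  shows "(\<Sum>k=-N..N. (-1) powi k * q powi binom2 k * (q powi k * E k))
     = (\<Sum>k=-N..N. (-1) powi k * q powi binom2 k * E k)"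
  by (subst (2) sum_symmetric[symmetric], intro sum.cong)
    (simp_all add: assms binom2_uminus power_int_minus_one_minus power_int_add)

text \<open>By \<open>sum_twist\<close>, twice the sum carries the weight \<open>1 + q^k\<close>;
  after multiplication by \<open>[l]\<close> it telescopes by \<open>rfact_split\<close>. For
  \<open>l = 0\<close> only \<open>k = 0\<close> survives.\<close>

lemma alternating_sum_delta:
  assumes "l \<le> N"
  shows "(\<Sum>k=-int N..int N. (-1) powi k * q powi binom2 k * (rfact q (int l + k) * rfact q (int l - k)))
     = (if l = 0 then 1 else 0)"
proof (cases "l = 0")
  case True
  have "(\<Sum>k=-int N..int N. (-1) powi k * q powi binom2 k * (rfact q (int l + k) * rfact q (int l - k)))
     = (\<Sum>k\<in>{0}. (-1) powi k * q powi binom2 k * (rfact q (int l + k) * rfact q (int l - k)))"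
  proof (rule sum.mono_neutral_right)
    show "\<forall>k\<in>{-int N..int N} - {0}. (-1) powi k * q powi binom2 k * (rfact q (int l + k) * rfact q (int l - k)) = 0"
      using True by (auto simp: rfact_def)
  qed auto
  then show ?thesis using True by (simp add: binom2_def)
next
  case False
  let ?E = "\<lambda>k. rfact q (int l + k) * rfact q (int l - k)"
  let ?w = "\<lambda>k. (-1) powi k * q powi binom2 k"
  define h where "h = (\<lambda>k. ?w k * (rfact q (int l - 1 + k) * rfact q (int l - k)))"
  have "qint_int q (int l) * (2 * (\<Sum>k=-int N..int N. ?w k * ?E k))
     = qint_int q (int l) * ((\<Sum>k=-int N..int N. ?w k * (q powi k * ?E k)) + (\<Sum>k=-int N..int N. ?w k * ?E k))"
    by (subst sum_twist) (simp_all add: mult.commute)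
  also have "\<dots> = (\<Sum>k=-int N..int N. h k - h (k + 1))"
    unfolding sum.distrib[symmetric] sum_distrib_left
  proof (rule sum.cong[OF refl])
    fix k
    have "qint_int q (int l) * (?w k * (q powi k * ?E k) + ?w k * ?E k)
       = ?w k * (qint_int q (int l) * (1 + q powi k) * ?E k)"
      by (simp add: algebra_simps)
    also have "\<dots> = h k - h (k + 1)"
      unfolding rfact_split by (simp add: h_def binom2_succ minus_one_powi_succ power_int_add diff_diff_eq algebra_simps)
    finally show "qint_int q (int l) * (?w k * (q powi k * ?E k) + ?w k * ?E k) = h k - h (k + 1)" .
  qed
  also have "\<dots> = 0"
    \<comment> \<open>At both ends, \<open>k = - N\<close> and \<open>k = N + 1\<close>, a factor of
      \<open>h\<close> has argument \<open>l - 1 - N < 0\<close>.\<close>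
    by (rule sum_telescope_int) (use assms False in \<open>auto simp: h_def\<close>)
  finally show ?thesis using False qint_int_pos_nonzero[of l] two_nonzero by simp
qed

text \<open>Merging the two nodes into \<open>l\<close> leaves the sum of
  \<open>alternating_sum_delta\<close>, so only \<open>l = 0\<close> contributes, with coefficient
  \<open>1\<close> or \<open>q^(M n)\<close> over \<open>[M]! [n]!\<close>.\<close>

lemma even_pair_sum:
  assumes d: "d \<in> {0, 1}"
  shows "qfact q M * qfact q n * qfact q (M + n) *
    (\<Sum>k=-int n..int n. (-1) powi k * q powi binom2 k * (q powi (d * k\<^sup>2) *
       ((rfact q (int M + k) * rfact q (int M - k)) * (rfact q (int n + k) * rfact q (int n - k)))))
    = (if d = 1 then 1 else q ^ (M * n))"
proof -
  let ?w = "\<lambda>l. if d = 1 then l * l else (int M - l) * (int n - l)"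
  let ?E = "\<lambda>l k. rfact q (int l + k) * rfact q (int l - k)"
  let ?s = "\<lambda>k. (-1) powi k * q powi binom2 k"
  let ?c = "\<lambda>l. q powi (?w (int l)) * rfact q (int M - int l) * rfact q (int n - int l)"
  have "qfact q (M + n) * (\<Sum>k=-int n..int n. ?s k * (q powi (d * k\<^sup>2) * (?E M k * ?E n k)))
     = (\<Sum>k=-int n..int n. \<Sum>l\<le>M. ?c l * (?s k * ?E l k))"
    unfolding sum_distrib_left
  proof (rule sum.cong[OF refl])
    fix k
    have "qfact q (M + n) * q powi (d * k\<^sup>2) * ?E M k * ?E n k = (\<Sum>l\<le>M. ?c l * ?E l k)"
      using merge_nodes[of 0 d M n k, unfolded add_0_right] d
      by (simp add: sum_int_atMost power2_eq_square nat_add_distrib)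
    then have "?s k * (qfact q (M + n) * q powi (d * k\<^sup>2) * ?E M k * ?E n k) = (\<Sum>l\<le>M. ?s k * (?c l * ?E l k))"
      by (simp only: sum_distrib_left)
    then show "qfact q (M + n) * (?s k * (q powi (d * k\<^sup>2) * (?E M k * ?E n k))) = (\<Sum>l\<le>M. ?c l * (?s k * ?E l k))"
      by (simp only: mult.assoc mult.left_commute mult.commute)
  qed
  also have "\<dots> = (\<Sum>l\<le>M. ?c l * (\<Sum>k=-int n..int n. ?s k * ?E l k))"
    by (subst sum.swap) (simp only: sum_distrib_left)
  also have "\<dots> = (\<Sum>l\<le>M. if l = 0 then ?c l else 0)"
  proof (rule sum.cong[OF refl])
    fix l
    show "?c l * (\<Sum>k=-int n..int n. ?s k * ?E l k) = (if l = 0 then ?c l else 0)"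
      \<comment> \<open>For \<open>l > n\<close> the coefficient itself is zero, because of
        \<open>rfact q (int n - int l)\<close>.\<close>
      by (cases "l \<le> n") (simp_all add: alternating_sum_delta)
  qed
  also have "\<dots> = ?c 0" by simp
  also have "?c 0 = (if d = 1 then 1 else q ^ (M * n)) * rfact q (int M) * rfact q (int n)"
    by (simp flip: power_int_of_nat)
  finally show ?thesis by (simp add: rfact_of_nat field_simps)
qed

text \<open>Averaging over \<open>k\<close> and \<open>- k\<close> turns the odd node \<open>m\<close> into the even node \<open>m + 1\<close>.\<close>

lemma mixed_pair_sum:
  assumes d: "d \<in> {0, 1}"
  shows "qfact q m * qfact q n * qfact q (m + n + 1) *
    (\<Sum>k=-int n..int n. (-1) powi k * q powi (d * k\<^sup>2 + binom2 k) *
       ((rfact q (int m + k) * rfact q (int m + 1 - k)) * (rfact q (int n + k) * rfact q (int n - k))))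
    = (if d = 1 then 1 else q ^ (Suc m * n))"
proof -
  let ?M = "int (Suc m)"
  let ?s = "\<lambda>k. (-1) powi k * q powi binom2 k"
  let ?v = "\<lambda>k. q powi (d * k\<^sup>2) * (rfact q (int n + k) * rfact q (int n - k))"
  let ?O = "\<lambda>k. rfact q (int m + k) * rfact q (int m + 1 - k)"
  let ?E = "\<lambda>k. rfact q (?M + k) * rfact q (?M - k)"
  let ?T = "\<Sum>k=-int n..int n. ?s k * (?O k * ?v k)"
  let ?U = "\<Sum>k=-int n..int n. ?s k * (?E k * ?v k)"
  have "2 * ?T = (\<Sum>k=-int n..int n. ?s k * (?O k * ?v k)) + (\<Sum>k=-int n..int n. ?s (-k) * (?O (-k) * ?v (-k)))"
    unfolding sum_symmetric[of "\<lambda>k. ?s k * (?O k * ?v k)"] by simp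
  also have "\<dots> = (\<Sum>k=-int n..int n. qint_int q ?M * (?s k * (q powi k * (?E k * ?v k)) + ?s k * (?E k * ?v k)))"
    unfolding sum.distrib[symmetric]
  proof (rule sum.cong[OF refl])
    fix k
    have "?s k * (?O k * ?v k) + ?s (-k) * (?O (-k) * ?v (-k)) = ?s k * ?v k * (?O k + q powi k * ?O (-k))"
      by (simp add: binom2_uminus power_int_minus_one_minus power_int_add algebra_simps)
    \<comment> \<open>This is \<open>rfact_split\<close> at \<open>m + 1\<close> read backwards: its
      two summands are the odd node at \<open>k\<close> and at \<open>- k\<close>.\<close>
    also have "?O k + q powi k * ?O (-k) = qint_int q ?M * (1 + q powi k) * ?E k"
      unfolding rfact_split by (simp add: algebra_simps)
    finally show "?s k * (?O k * ?v k) + ?s (-k) * (?O (-k) * ?v (-k))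
       = qint_int q ?M * (?s k * (q powi k * (?E k * ?v k)) + ?s k * (?E k * ?v k))"
      by (simp only: distrib_left distrib_right mult_1_left mult_1_right add.commute mult_ac)
  qed
  also have "\<dots> = qint_int q ?M * ((\<Sum>k=-int n..int n. ?s k * (q powi k * (?E k * ?v k))) + ?U)"
    by (simp only: sum.distrib sum_distrib_left[symmetric])
  also have "(\<Sum>k=-int n..int n. ?s k * (q powi k * (?E k * ?v k))) = ?U"
    by (rule sum_twist) (simp add: mult_ac)
  finally have "2 * ?T = 2 * (qint_int q ?M * ?U)" by (simp only: mult_2 distrib_left)
  then have T: "?T = qint_int q ?M * ?U" using mult_left_cancel[OF two_nonzero] by blast
  have "(\<Sum>k=-int n..int n. (-1) powi k * q powi (d * k\<^sup>2 + binom2 k) *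
       (?O k * (rfact q (int n + k) * rfact q (int n - k)))) = ?T"
    by (rule sum.cong) (simp_all only: power_int_add[OF disjI1[OF q_nonzero]] mult_ac)
  moreover have "qfact q m * qfact q n * qfact q (m + n + 1) * ?T = qfact q (Suc m) * qfact q n * qfact q (Suc m + n) * ?U"
    unfolding T qfact_Suc[of m] by (simp only: mult_ac add_ac Suc_eq_plus1)
  moreover have "?U = (\<Sum>k=-int n..int n. ?s k * (q powi (d * k\<^sup>2) *
       (?E k * (rfact q (int n + k) * rfact q (int n - k)))))"
    by (rule sum.cong) (simp_all only: mult_ac)
  ultimately show ?thesis using even_pair_sum[OF d, of "Suc m" n] by (simp only:)
qed

end

section \<open>The indeterminate and polynomials with non-negative coefficients\<close>

lemma qvar_power: "qvar ^ n = to_fract (monom 1 n)"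
proof (induction n)
  case (Suc n)
  have "monom 1 (Suc n) = [:0, 1:] * (monom 1 n :: int poly)"
    by (simp add: monom_Suc)
  then show ?case using Suc by (simp only: power_Suc qvar_def to_fract_mult)
qed (simp add: monom_0 pCons_one)

interpretation qvar: generic_q qvar
proof
  show "qvar \<noteq> 0" by (simp add: qvar_def)
  show "qvar ^ n \<noteq> 1" if "n > 0" for n
  proof -
    have "monom 1 n \<noteq> (1 :: int poly)"
      using that by (metis degree_1 degree_monom_eq less_numeral_extra(3) one_neq_zero)
    then show ?thesis by (metis qvar_power to_fract_1 to_fract_eq_iff)
  qed
  have "(2 :: int poly fract) = to_fract 2"
    by (metis one_add_one to_fract_1 to_fract_add)
  then show "(2 :: int poly fract) \<noteq> 0" by simp
qed

lemma nonneg_int_polynomial_0 [simp]: "nonneg_int_polynomial 0"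
  unfolding nonneg_int_polynomial_def by (rule exI[of _ 0]) simp

lemma nonneg_int_polynomial_1 [simp]: "nonneg_int_polynomial 1"
  unfolding nonneg_int_polynomial_def by (rule exI[of _ 1]) simp

lemma nonneg_int_polynomial_add:
  assumes "nonneg_int_polynomial f" "nonneg_int_polynomial g"
  shows "nonneg_int_polynomial (f + g)"
  using assms unfolding nonneg_int_polynomial_def
  by (metis to_fract_add coeff_add add_nonneg_nonneg)

lemma nonneg_int_polynomial_mult:
  assumes "nonneg_int_polynomial f" "nonneg_int_polynomial g"
  shows "nonneg_int_polynomial (f * g)"
proof -
  obtain p p' where "f = to_fract p" "\<forall>i. coeff p i \<ge> 0" "g = to_fract p'" "\<forall>i. coeff p' i \<ge> 0"
    using assms unfolding nonneg_int_polynomial_def by blast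
  then show ?thesis unfolding nonneg_int_polynomial_def
    by (intro exI[of _ "p * p'"]) (simp add: coeff_mult sum_nonneg)
qed

lemma nonneg_int_polynomial_power:
  "nonneg_int_polynomial f \<Longrightarrow> nonneg_int_polynomial (f ^ n)"
  by (induction n) (simp_all add: nonneg_int_polynomial_mult)

lemma nonneg_int_polynomial_qvar: "nonneg_int_polynomial qvar"
  unfolding nonneg_int_polynomial_def qvar_def
  by (rule exI[of _ "[:0, 1:]"]) (simp add: coeff_pCons split: nat.split)

lemma nonneg_int_polynomial_qvar_powi:
  "i \<ge> 0 \<Longrightarrow> nonneg_int_polynomial (qvar powi i)"
  by (simp add: power_int_def nonneg_int_polynomial_power nonneg_int_polynomial_qvar)

lemma nonneg_int_polynomial_gauss: "nonneg_int_polynomial (gauss qvar N K)"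
proof (induction N arbitrary: K)
  case 0
  then show ?case by (simp add: qvar.gauss_0)
next
  case (Suc N)
  show ?case
  \<comment> \<open>Pascal's rule contains \<open>qvar powi K\<close>, a polynomial only for
    \<open>K \<ge> 0\<close>.\<close>
  proof (cases "K < 0")
    case False
    then show ?thesis unfolding qvar.gauss_pascal
      by (intro nonneg_int_polynomial_add nonneg_int_polynomial_mult nonneg_int_polynomial_qvar_powi Suc) auto
  qed (simp add: gauss_neg)
qed

text \<open>Combinations of functions of the summation variable \<open>k\<close> with non-negative
  polynomials, independent of \<open>k\<close>, as coefficients. The values of the functions may be
  arbitrary rational functions.\<close>

inductive_set nn_span :: "('b \<Rightarrow> int poly fract) set \<Rightarrow> ('b \<Rightarrow> int poly fract) set" for G where
  zero: "(\<lambda>_. 0) \<in> nn_span G"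
| add: "\<lbrakk>f \<in> nn_span G; g \<in> G; nonneg_int_polynomial c\<rbrakk> \<Longrightarrow> (\<lambda>k. f k + c * g k) \<in> nn_span G"

lemma nn_span_base: "g \<in> G \<Longrightarrow> g \<in> nn_span G"
  using nn_span.add[OF nn_span.zero, of g G 1] by simp

lemma nn_span_mono: "f \<in> nn_span G \<Longrightarrow> G \<subseteq> H \<Longrightarrow> f \<in> nn_span H"
  by (induction rule: nn_span.induct) (auto intro: nn_span.intros)

lemma nn_span_add:
  assumes "g \<in> nn_span G" "f \<in> nn_span G"
  shows "(\<lambda>k. f k + g k) \<in> nn_span G"
  using assms
proof (induction rule: nn_span.induct)
  case (add g h c)
  then show ?case using nn_span.add[of "\<lambda>k. f k + g k" G h c] by (simp add: add.assoc)
qed simp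

lemma nn_span_scale:
  assumes "f \<in> nn_span G" "nonneg_int_polynomial c"
  shows "(\<lambda>k. c * f k) \<in> nn_span G"
  using assms
proof (induction rule: nn_span.induct)
  case (add g h c')
  then show ?case using nn_span.add[of "\<lambda>k. c * g k" G h "c * c'"]
    by (simp add: distrib_left mult.assoc nonneg_int_polynomial_mult)
qed (simp add: nn_span.zero)

lemma nn_span_combination:
  assumes "finite I" "\<And>i. i \<in> I \<Longrightarrow> nonneg_int_polynomial (c i)" "\<And>i. i \<in> I \<Longrightarrow> f i \<in> nn_span G"
  shows "(\<lambda>k. \<Sum>i\<in>I. c i * f i k) \<in> nn_span G"
  using assms
proof (induction rule: finite_induct)
  case (insert i I)
  then show ?case
    using nn_span_add[of "\<lambda>k. \<Sum>i\<in>I. c i * f i k" G "\<lambda>k. c i * f i k"] nn_span_scale[of "f i" G "c i"]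
    by simp
qed (simp add: nn_span.zero)

text \<open>The weighted sum is linear in \<open>f\<close>, so positivity has to be checked on
  generators only. This reduces the theorem to pairs of single nodes.\<close>

lemma nn_span_sum:
  assumes "f \<in> nn_span G" "\<And>g. g \<in> G \<Longrightarrow> nonneg_int_polynomial (\<Sum>k\<in>A. w k * g k)"
  shows "nonneg_int_polynomial (\<Sum>k\<in>A. w k * f k)"
  using assms(1)
proof (induction rule: nn_span.induct)
  case (add f g c)
  have "(\<Sum>k\<in>A. w k * (f k + c * g k)) = (\<Sum>k\<in>A. w k * f k) + c * (\<Sum>k\<in>A. w k * g k)"
    by (simp add: distrib_left sum.distrib sum_distrib_left mult_ac)
  then show ?case using add assms(2) by (simp add: nonneg_int_polynomial_add nonneg_int_polynomial_mult)
qed simp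

section \<open>Reducing a chain of nodes to single nodes\<close>

text \<open>A fully reduced chain: one node \<open>l\<close> with neighbour \<open>t\<close> and no
  power of \<open>q\<close> left.\<close>

definition node_term :: "nat \<Rightarrow> nat \<Rightarrow> nat \<Rightarrow> int \<Rightarrow> int poly fract" where
  "node_term e t l k = qfact qvar l * qfact qvar (l + t + e) *
     (rfact qvar (int l + k) * rfact qvar (int l + int e - k))"

text \<open>The node \<open>x (Suc s)\<close> occurs only in the last factorial; it stands for the adjacent
  node of the other family on the path.\<close>

definition chain :: "nat \<Rightarrow> int \<Rightarrow> nat \<Rightarrow> (nat \<Rightarrow> nat) \<Rightarrow> int \<Rightarrow> int poly fract" where
  "chain e a s x k = qfact qvar (x 0) * (\<Prod>i\<le>s. qfact qvar (x i + x (Suc i) + e)) *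
     qvar powi (a * (k * (k - int e))) * (\<Prod>i\<le>s. rfact qvar (int (x i) + k) * rfact qvar (int (x i) + int e - k))"

text \<open>\<open>merge_nodes\<close> replaces \<open>x 0\<close> and \<open>x 1\<close> by
  \<open>l\<close>. The leftover \<open>1/[x 0 - l]!\<close> and \<open>1/[x 1 - l]!\<close> are
  completed to Gaussian coefficients by the quotients of the old outer factorials
  \<open>[x 0]!\<close> and \<open>[x 1 + x 2 + e]!\<close> by the new ones \<open>[l]!\<close> and
  \<open>[l + x 2 + e]!\<close>.\<close>

lemma chain_step:
  fixes x :: "nat \<Rightarrow> nat" and d :: int and e :: nat
  assumes e: "e \<le> 1" and d: "d \<in> {0, 1}"
  defines "w \<equiv> \<lambda>l. if d = 1 then int l * (int l + int e) else (int (x 0) - int l) * (int (x 1) - int l)"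
  shows "chain e a (Suc s) x k = (\<Sum>l\<le>x 0. qvar powi (w l) * gauss qvar (x 0) (int l) *
     gauss qvar (x 1 + x 2 + e) (int (x 1) - int l) * chain e (a - d) s (\<lambda>i. if i = 0 then l else x (Suc i)) k)"
proof -
  let ?R = "\<lambda>l. rfact qvar (int l + k) * rfact qvar (int l + int e - k)"
  define E where "E = (\<Prod>i<s. qfact qvar (x (Suc (Suc i)) + x (Suc (Suc (Suc i))) + e))"
  define P where "P = (\<Prod>i<s. ?R (x (Suc (Suc i))))"
  define y where "y = (\<lambda>l i. if i = 0 then l else x (Suc i))"
  let ?Q = "qvar powi ((a - d) * (k * (k - int e)))"
  let ?D = "qvar powi (d * (k * (k - int e)))"
  have Qa: "qvar powi (a * (k * (k - int e))) = ?D * ?Q"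
    by (simp flip: power_int_add add: algebra_simps)
  have "chain e a (Suc s) x k = qfact qvar (x 0) * (qfact qvar (x 0 + x 1 + e) * (qfact qvar (x 1 + x 2 + e) * E)) *
      (?D * ?Q) * (?R (x 0) * (?R (x 1) * P))"
    unfolding chain_def Qa E_def P_def
    by (simp only: prod.atMost_shift prod.lessThan_Suc_shift numeral_2_eq_2 One_nat_def)
  also have "\<dots> = qfact qvar (x 0) * qfact qvar (x 1 + x 2 + e) * E * ?Q * P *
      (qfact qvar (x 0 + x 1 + e) * ?D * ?R (x 0) * ?R (x 1))"
    by (simp only: mult_ac)
  also have "qfact qvar (x 0 + x 1 + e) * ?D * ?R (x 0) * ?R (x 1) =
      (\<Sum>l\<le>x 0. qvar powi (w l) * rfact qvar (int (x 0) - int l) * rfact qvar (int (x 1) - int l) * ?R l)"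
  proof -
    have *: "nat (int (x 0) + int (x 1) + int e) = x 0 + x 1 + e" by simp
    have "int e = 0 \<or> int e = 1" using e by auto
    from qvar.merge_nodes[OF this d, of "x 0" "x 1" k] show ?thesis
      unfolding sum_int_atMost w_def * .
  qed
  also have "qfact qvar (x 0) * qfact qvar (x 1 + x 2 + e) * E * ?Q * P * \<dots> =
      (\<Sum>l\<le>x 0. qvar powi (w l) * gauss qvar (x 0) (int l) *
         gauss qvar (x 1 + x 2 + e) (int (x 1) - int l) * chain e (a - d) s (y l) k)"
    unfolding sum_distrib_left
  proof (rule sum.cong[OF refl])
    fix l
    have c: "chain e (a - d) s (y l) k = qfact qvar l * (qfact qvar (l + x 2 + e) * E) * ?Q * (?R l * P)"
      unfolding chain_def E_def P_def prod.atMost_shift by (simp add: y_def numeral_2_eq_2)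
    have g: "gauss qvar (x 1 + x 2 + e) (int (x 1) - int l) =
        qfact qvar (x 1 + x 2 + e) * rfact qvar (int (x 1) - int l) * rfact qvar (int (l + x 2 + e))"
      unfolding gauss_def by (simp add: algebra_simps)
    have 1: "qfact qvar l * rfact qvar (int l) = 1" "qfact qvar (l + x 2 + e) * rfact qvar (int (l + x 2 + e)) = 1"
      by (simp_all only: rfact_of_nat) simp_all
    have "qvar powi (w l) * gauss qvar (x 0) (int l) *
         gauss qvar (x 1 + x 2 + e) (int (x 1) - int l) * chain e (a - d) s (y l) k =
       qfact qvar (x 0) * qfact qvar (x 1 + x 2 + e) * E * ?Q * P *
         (qvar powi (w l) * rfact qvar (int (x 0) - int l) * rfact qvar (int (x 1) - int l) * ?R l) *
       (qfact qvar l * rfact qvar (int l)) * (qfact qvar (l + x 2 + e) * rfact qvar (int (l + x 2 + e)))"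
      unfolding c g gauss_def[of _ "x 0"] by (simp only: mult_ac)
    then show "qfact qvar (x 0) * qfact qvar (x 1 + x 2 + e) * E * ?Q * P *
         (qvar powi (w l) * rfact qvar (int (x 0) - int l) * rfact qvar (int (x 1) - int l) * ?R l) =
       qvar powi (w l) * gauss qvar (x 0) (int l) *
         gauss qvar (x 1 + x 2 + e) (int (x 1) - int l) * chain e (a - d) s (y l) k"
      by (simp only: 1 mult_1_right)
  qed
  finally show ?thesis by (simp only: y_def)
qed

text \<open>Induction on \<open>s\<close> by \<open>chain_step\<close>, lowering \<open>a\<close>
  whenever it is positive; this keeps \<open>0 \<le> a - d \<le> s\<close> for the shorter
  chain.\<close>

lemma chain_in_span:
  assumes e: "e \<le> 1" and a: "0 \<le> a" "a \<le> int s"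
  shows "chain e a s x \<in> nn_span (node_term e (x (Suc s)) ` {..x 0})"
  using a
proof (induction s arbitrary: x a)
  case 0
  then have "chain e a 0 x = node_term e (x (Suc 0)) (x 0)"
    by (auto simp: chain_def node_term_def fun_eq_iff)
  then show ?case by (auto intro: nn_span_base)
next
  case (Suc s)
  define d :: int where "d = (if a = 0 then 0 else 1)"
  have d: "d \<in> {0, 1}" "0 \<le> a - d" "a - d \<le> int s"
    using Suc.prems by (auto simp: d_def)
  define y where "y = (\<lambda>l i. if i = 0 then l else x (Suc i))"
  define c where "c = (\<lambda>l. qvar powi (if d = 1 then int l * (int l + int e) else (int (x 0) - int l) * (int (x 1) - int l))
       * gauss qvar (x 0) (int l) * gauss qvar (x 1 + x 2 + e) (int (x 1) - int l))"
  have "chain e a (Suc s) x = (\<lambda>k. \<Sum>l\<in>{..x 0}. c l * chain e (a - d) s (y l) k)"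
    unfolding c_def y_def by (rule ext, rule chain_step[OF e d(1)])
  also have "\<dots> \<in> nn_span (node_term e (x (Suc (Suc s))) ` {..x 0})"
  proof (rule nn_span_combination)
    fix l assume "l \<in> {..x 0}"
    then have l: "l \<le> x 0" by simp
    have "chain e (a - d) s (y l) \<in> nn_span (node_term e (y l (Suc s)) ` {..y l 0})"
      using d by (intro Suc.IH) auto
    then show "chain e (a - d) s (y l) \<in> nn_span (node_term e (x (Suc (Suc s))) ` {..x 0})"
      by (rule nn_span_mono) (use l in \<open>auto simp: y_def\<close>)
    show "nonneg_int_polynomial (c l)"
    \<comment> \<open>The exponent \<open>(x 0 - l) (x 1 - l)\<close> may be negative for
      \<open>l > x 1\<close>, but then the second Gaussian coefficient vanishes.\<close>
    proof (cases "l \<le> x 1")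
      case True
      then show ?thesis using l unfolding c_def
        by (intro nonneg_int_polynomial_mult nonneg_int_polynomial_gauss nonneg_int_polynomial_qvar_powi) auto
    qed (simp add: c_def gauss_neg)
  qed simp
  finally show ?case .
qed

section \<open>Rewriting \<open>F\<close> and assembling the proof\<close>

text \<open>A cyclic shift of the factors with \<open>m (i + 1)\<close> collects both reciprocal
  factorials of each node. The closing edge stays separate, as it cancels against the prefactor of
  \<open>F\<close>.\<close>

lemma qbinom_cyclic_prod:
  assumes "m (Suc (Suc r)) = m 1"
  shows "(\<Prod>i=1..Suc r. qbinom q (int (m i) + int (m (i + 1)) + int e) (int (m i) + k)) =
    (\<Prod>i<r. qfact q (m (Suc i) + m (Suc (Suc i)) + e)) * qfact q (m (Suc r) + m 1 + e) *
    (\<Prod>i\<le>r. rfact q (int (m (Suc i)) + k) * rfact q (int (m (Suc i)) + int e - k))"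
proof -
  have "(\<Prod>i=1..Suc r. qbinom q (int (m i) + int (m (i + 1)) + int e) (int (m i) + k)) =
    (\<Prod>i\<le>r. qbinom q (int (m (Suc i) + m (Suc (Suc i)) + e)) (int (m (Suc i)) + k))"
    by (rule prod.reindex_bij_witness[of _ Suc "\<lambda>i. i - 1"]) auto
  also have "\<dots> = (\<Prod>i\<le>r. qfact q (m (Suc i) + m (Suc (Suc i)) + e)) *
     (\<Prod>i\<le>r. rfact q (int (m (Suc i)) + k)) * (\<Prod>i\<le>r. rfact q (int (m (Suc (Suc i))) + int e - k))"
    unfolding qbinom_eq_gauss prod.distrib[symmetric] by (simp add: gauss_def algebra_simps)
  also have "(\<Prod>i\<le>r. rfact q (int (m (Suc (Suc i))) + int e - k)) = (\<Prod>i\<le>r. rfact q (int (m (Suc i)) + int e - k))"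
    unfolding prod.atMost_shift[of "\<lambda>i. rfact q (int (m (Suc i)) + int e - k)"]
    unfolding lessThan_Suc_atMost[symmetric] prod.lessThan_Suc by (simp add: assms mult.commute)
  also have "(\<Prod>i\<le>r. qfact q (m (Suc i) + m (Suc (Suc i)) + e)) =
     (\<Prod>i<r. qfact q (m (Suc i) + m (Suc (Suc i)) + e)) * qfact q (m (Suc r) + m 1 + e)"
    unfolding lessThan_Suc_atMost[symmetric] prod.lessThan_Suc by (simp add: assms)
  finally show ?thesis by (simp only: prod.distrib mult.assoc)
qed

theorem theorem1p2:
  fixes r s :: nat and m n :: "nat \<Rightarrow> nat" and a b :: int
  assumes "r > 1" and "s > 1"
    and "\<And>i. 1 \<le> i \<Longrightarrow> i \<le> r \<Longrightarrow> m i > 0"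
    and "\<And>j. 1 \<le> j \<Longrightarrow> j \<le> s \<Longrightarrow> n j > 0"
    and "m (r + 1) = m 1" and "n (s + 1) = n 1"
    and "0 \<le> a" and "a \<le> int s"
    and "1 \<le> b" and "b \<le> int r"
  shows "nonneg_int_polynomial (F r s b m n a qvar)"
proof -
  define r' s' where "r' = r - 1" and "s' = s - 1"
  have rs: "r = Suc r'" "s = Suc s'" using assms by (auto simp: r'_def s'_def)
  \<comment> \<open>The chain of \<open>n\<close> allows only \<open>s - 1\<close> merges, so for
    \<open>a = s\<close> one factor \<open>q^(k^2)\<close> is kept for the final pair.\<close>
  define d :: int where "d = (if a = int s then 1 else 0)"
  define w where "w = (\<lambda>k. (-1) powi k * qvar powi (d * k\<^sup>2 + binom2 k) :: int poly fract)"
  define PM where "PM = (\<lambda>k. \<Prod>i\<le>r'. rfact qvar (int (m (Suc i)) + k) * rfact qvar (int (m (Suc i)) + 1 - k))"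
  define PN where "PN = (\<lambda>k. \<Prod>i\<le>s'. rfact qvar (int (n (Suc i)) + k) * rfact qvar (int (n (Suc i)) - k))"
  define QM where "QM = (\<Prod>i<r'. qfact qvar (m (Suc i) + m (Suc (Suc i)) + 1))"
  define QN where "QN = (\<Prod>i<s'. qfact qvar (n (Suc i) + n (Suc (Suc i))))"
  \<comment> \<open>The edge factorial joining \<open>m r\<close> and \<open>n s\<close> is given to
    \<open>f\<close>, which makes \<open>f\<close> a complete chain; \<open>g\<close> still lacks
    its last edge.\<close>
  define f where "f = (\<lambda>k. qfact qvar (m 1) * (QM * qfact qvar (m r + n s + 1)) * qvar powi ((b - 1) * (k * (k - 1))) * PM k)"
  define g where "g = (\<lambda>k. qfact qvar (n 1) * QN * qvar powi ((a - d) * k\<^sup>2) * PN k)"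
  have F: "F r s b m n a qvar = (\<Sum>k=-int (n 1)..int (n 1). w k * g k * f k)"
  proof -
    have M: "(\<Prod>i=1..r. qbinom qvar (int (m i) + int (m (i + 1)) + 1) (int (m i) + k)) =
        QM * qfact qvar (m r + m 1 + 1) * PM k" for k
      unfolding QM_def PM_def using qbinom_cyclic_prod[where m=m and e=1 and r=r' and q=qvar and k=k] assms(5)
      by (simp add: rs del: prod.cl_ivl_Suc)
    have N: "(\<Prod>j=1..s. qbinom qvar (int (n j) + int (n (j + 1))) (int (n j) + k)) =
        QN * qfact qvar (n s + n 1) * PN k" for k
      unfolding QN_def PN_def using qbinom_cyclic_prod[where m=n and e=0 and r=s' and q=qvar and k=k] assms(6)
      by (simp add: rs del: prod.cl_ivl_Suc)
    have "F r s b m n a qvar = qfact qvar (m 1) * qfact qvar (n 1) * qfact qvar (m r + n s + 1) /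
       (qfact qvar (m 1 + m r + 1) * qfact qvar (n 1 + n s)) *
       (\<Sum>k=-int (n 1)..int (n 1). (-1) powi k * qvar powi (a * k\<^sup>2 + (2 * b - 1) * binom2 k) *
          (QM * qfact qvar (m r + m 1 + 1) * PM k) * (QN * qfact qvar (n s + n 1) * PN k))"
      unfolding F_def M N ..
    also have "\<dots> = (\<Sum>k=-int (n 1)..int (n 1). w k * g k * f k)"
      unfolding sum_distrib_left
    proof (rule sum.cong[OF refl])
      fix k
      have "(2 * b - 1) * binom2 k = (b - 1) * (2 * binom2 k) + binom2 k"
        by (simp add: algebra_simps)
      then have "a * k\<^sup>2 + (2 * b - 1) * binom2 k
          = (d * k\<^sup>2 + binom2 k) + (a - d) * k\<^sup>2 + (b - 1) * (k * (k - 1))"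
        unfolding double_binom2 by (simp add: algebra_simps)
      then have *: "qvar powi (a * k\<^sup>2 + (2 * b - 1) * binom2 k)
          = qvar powi (d * k\<^sup>2 + binom2 k) * qvar powi ((a - d) * k\<^sup>2) * qvar powi ((b - 1) * (k * (k - 1)))"
        by (simp only: power_int_add qvar.q_nonzero simp_thms)
      show "qfact qvar (m 1) * qfact qvar (n 1) * qfact qvar (m r + n s + 1) /
         (qfact qvar (m 1 + m r + 1) * qfact qvar (n 1 + n s)) *
         ((-1) powi k * qvar powi (a * k\<^sup>2 + (2 * b - 1) * binom2 k) *
          (QM * qfact qvar (m r + m 1 + 1) * PM k) * (QN * qfact qvar (n s + n 1) * PN k)) = w k * g k * f k"
        unfolding * w_def f_def g_def by (simp add: field_simps)
    qed
    finally show ?thesis .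
  qed
  have f: "f \<in> nn_span (node_term 1 (n s) ` {..m 1})"
  proof -
    define x where "x = (\<lambda>i. if i = r then n s else m (Suc i))"
    have "(\<lambda>k. chain 1 (b - 1) r' x k) \<in> nn_span (node_term 1 (x (Suc r')) ` {..x 0})"
      by (rule chain_in_span) (use assms rs in auto)
    moreover have "chain 1 (b - 1) r' x = f"
    proof
      fix k
      have "(\<Prod>i\<le>r'. qfact qvar (x i + x (Suc i) + 1)) = QM * qfact qvar (m r + n s + 1)"
        unfolding QM_def lessThan_Suc_atMost[symmetric] prod.lessThan_Suc
        by (simp add: x_def rs)
      moreover have "(\<Prod>i\<le>r'. rfact qvar (int (x i) + k) * rfact qvar (int (x i) + 1 - k)) = PM k"
        unfolding PM_def by (rule prod.cong) (auto simp: x_def rs)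
      ultimately show "chain 1 (b - 1) r' x k = f k"
        by (simp add: chain_def f_def x_def rs)
    qed
    ultimately show ?thesis by (simp add: x_def rs)
  qed
  \<comment> \<open>Once \<open>f\<close> is reduced to a node \<open>l\<close>, its edge factorial
    \<open>[l + n s + 1]!\<close> is the missing last edge of \<open>g\<close>, with
    \<open>l + 1\<close> as neighbour because \<open>e = 0\<close> there.\<close>
  have g: "(\<lambda>k. qfact qvar (n s + Suc l) * g k) \<in> nn_span (node_term 0 (Suc l) ` {..n 1})" for l
  proof -
    define x where "x = (\<lambda>i. if i = s then Suc l else n (Suc i))"
    have "(\<lambda>k. chain 0 (a - d) s' x k) \<in> nn_span (node_term 0 (x (Suc s')) ` {..x 0})"
      by (rule chain_in_span) (use assms rs in \<open>auto simp: d_def\<close>)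
    moreover have "chain 0 (a - d) s' x k = qfact qvar (n s + Suc l) * g k" for k
    proof -
      have "(\<Prod>i\<le>s'. qfact qvar (x i + x (Suc i) + 0)) = QN * qfact qvar (n s + Suc l)"
        unfolding QN_def lessThan_Suc_atMost[symmetric] prod.lessThan_Suc
        by (simp add: x_def rs)
      moreover have "(\<Prod>i\<le>s'. rfact qvar (int (x i) + k) * rfact qvar (int (x i) - k)) = PN k"
        unfolding PN_def by (rule prod.cong) (auto simp: x_def rs)
      ultimately show ?thesis
        by (simp add: chain_def g_def x_def rs power2_eq_square)
    qed
    ultimately show ?thesis by (simp add: x_def rs)
  qed
  show ?thesis unfolding F
  proof (rule nn_span_sum[OF f])
    fix h assume "h \<in> node_term 1 (n s) ` {..m 1}"
    then obtain l where h: "h = node_term 1 (n s) l" by auto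
    let ?u = "\<lambda>k. w k * (qfact qvar l * (rfact qvar (int l + k) * rfact qvar (int l + 1 - k)))"
    have "nonneg_int_polynomial (\<Sum>k=-int (n 1)..int (n 1). ?u k * (qfact qvar (n s + Suc l) * g k))"
    proof (rule nn_span_sum[OF g])
      fix h' assume "h' \<in> node_term 0 (Suc l) ` {..n 1}"
      then obtain l' where l': "l' \<le> n 1" and h': "h' = node_term 0 (Suc l) l'" by auto
      have "(\<Sum>k=-int (n 1)..int (n 1). ?u k * h' k) = (\<Sum>k=-int l'..int l'. ?u k * h' k)"
        \<comment> \<open>For \<open>\<bar>k\<bar> > l'\<close> one of the reciprocal factorials of
          the node \<open>l'\<close> is zero.\<close>
        by (rule sum.mono_neutral_right) (use l' in \<open>auto simp: h' node_term_def rfact_def\<close>)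
      also have "\<dots> = qfact qvar l * qfact qvar l' * qfact qvar (l + l' + 1) *
         (\<Sum>k=-int l'..int l'. (-1) powi k * qvar powi (d * k\<^sup>2 + binom2 k) *
         ((rfact qvar (int l + k) * rfact qvar (int l + 1 - k)) * (rfact qvar (int l' + k) * rfact qvar (int l' - k))))"
        unfolding sum_distrib_left
        by (rule sum.cong) (simp_all add: h' node_term_def w_def mult_ac add_ac)
      also have "\<dots> = (if d = 1 then 1 else qvar ^ (Suc l * l'))"
        by (rule qvar.mixed_pair_sum) (auto simp: d_def)
      finally show "nonneg_int_polynomial (\<Sum>k=-int (n 1)..int (n 1). ?u k * h' k)"
        by (simp add: nonneg_int_polynomial_power nonneg_int_polynomial_qvar)
    qed
    also have "(\<Sum>k=-int (n 1)..int (n 1). ?u k * (qfact qvar (n s + Suc l) * g k))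
       = (\<Sum>k=-int (n 1)..int (n 1). w k * g k * h k)"
      by (rule sum.cong) (simp_all add: h node_term_def mult_ac add_ac)
    finally show "nonneg_int_polynomial (\<Sum>k=-int (n 1)..int (n 1). w k * g k * h k)" .
  qed
qed

end
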